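(* Fix an integer $b\ge 2$ and $m\in\mathbb N_0$, and let the tensor network approximation sets be defined with $S=\mathbb P_m$ (see context). If $f$ is analytic on an open domain containing $[0,1]$, then there are constants $C,\rho>1$ such that for all $n\in\mathbb N$ $$E_n^{\mathcal N}(f)_\infty\le C\rho^{-n^{1/2}},\qquad E_n^{\mathcal S}(f)_\infty\le E_n^{\mathcal C}(f)_\infty\le C\rho^{-n^{1/3}}.$$
   Context: Functions are real-valued on $[0,1)$; $\mathbb N=\{1,2,\dots\}$. $\mathbb P_m$ is the space of polynomials of degree at most $m$. Tensor networks. Let $I_b=\{0,\dots,b-1\}$. For $d\in\mathbb N$ and $f:[0,1)\to\mathbb R$, the tensorization is $(T_{b,d}f)(i_1,\dots,i_d,y)=f\big(\sum_{k=1}^d i_kb^{-k}+b^{-d}y\big)$, $i_k\in I_b$, $y\in[0,1)$. Fix a basis $(\varphi_k)_{k=1}^{m+1}$ of $\mathbb P_m$. For $d\in\mathbb N$ and $\boldsymbol r=(r_1,\dots,r_d)\in\mathbb N^d$, a tensor network is a tuple $\mathbf v=(v_1,\dots,v_{d+1})\in\mathbb R^{b\times r_1}\times\mathbb R^{b\times r_1\times r_2}\times\cdots\times\mathbb R^{b\times r_{d-1}\times r_d}\times\mathbb R^{r_d\times(m+1)}$; its realization is the function $f$ with $$(T_{b,d}f)(i_1,\dots,i_d,y)=\sum_{k_1=1}^{r_1}\cdots\sum_{k_d=1}^{r_d}\sum_{k_{d+1}=1}^{m+1}v_1^{k_1}(i_1)v_2^{k_1,k_2}(i_2)\cdots v_d^{k_{d-1},k_d}(i_d)v_{d+1}^{k_d,k_{d+1}}\varphi_{k_{d+1}}(y).$$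 Complexities of $\mathbf v$: $\mathrm{compl}_{\mathcal N}(\mathbf v)=\sum_{\nu=1}^d r_\nu$; $\mathrm{compl}_{\mathcal C}(\mathbf v)=br_1+b\sum_{k=2}^d r_{k-1}r_k+r_d(m+1)$; $\mathrm{compl}_{\mathcal S}(\mathbf v)=\sum_{\nu=1}^{d+1}\|v_\nu\|_{\ell_0}$ (number of non-zero entries). The complexity of a function is the minimum of the complexity over all tensor networks (all $d$, $\boldsymbol r$) realizing it. For $n\in\mathbb N$, $\Phi_n^{\mathcal N},\Phi_n^{\mathcal C},\Phi_n^{\mathcal S}$ are the sets of functions realizable by tensor networks whose respective complexity is at most $n$; moreover $0\in\Phi_n$ for all $n$. For $\mathcal X\in\{\mathcal N,\mathcal C,\mathcal S\}$, $E_n^{\mathcal X}(f)_\infty=\inf_{\varphi\in\Phi_n^{\mathcal X}}\|f-\varphi\|_{L^\infty([0,1))}$. *)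

theory Defs
  imports
    "HOL-Analysis.Analysis"
    "HOL-Probability.Essential_Supremum"
    "HOL-Computational_Algebra.Polynomial"
begin

text \<open>
  Functions on \<open>[0,1)\<close> are represented by total functions \<open>real \<Rightarrow> real\<close>; only the values on
  \<open>{0..<1}\<close> matter below. Tuples \<open>(i\<^sub>1, \<dots>, i\<^sub>d)\<close> and \<open>(r\<^sub>1, \<dots>, r\<^sub>d)\<close> are functions on \<open>nat\<close>
  read on \<open>{1..d}\<close>.
\<close>

definition tensorization ::
    "nat \<Rightarrow> nat \<Rightarrow> (real \<Rightarrow> real) \<Rightarrow> (nat \<Rightarrow> nat) \<Rightarrow> real \<Rightarrow> real" where
  "tensorization b d f i y = f ((\<Sum>k=1..d. real (i k) / real b ^ k) + y / real b ^ d)"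

definition is_poly_basis :: "nat \<Rightarrow> (nat \<Rightarrow> real poly) \<Rightarrow> bool" where
  "is_poly_basis m \<phi> \<longleftrightarrow>
     inj_on \<phi> {1..m+1} \<and>
     \<not> module.dependent smult (\<phi> ` {1..m+1}) \<and>
     module.span smult (\<phi> ` {1..m+1}) = {p. degree p \<le> m}"

text \<open>
  The cores of a network: \<open>first_core i k\<^sub>1\<close> is the entry of \<open>v\<^sub>1\<close>, \<open>mid_core \<nu> i k\<^sub>\<nu>\<^sub>-\<^sub>1 k\<^sub>\<nu>\<close> that of
  \<open>v\<^sub>\<nu>\<close> for \<open>2 \<le> \<nu> \<le> d\<close>, and \<open>last_core k\<^sub>d q\<close> that of \<open>v\<^sub>d\<^sub>+\<^sub>1\<close>. Entries whose indices are outside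
  the ranges given by \<open>b\<close>, \<open>m\<close> and the ranks are junk and are never inspected.
\<close>

record tensor_network =
  depth :: nat
  ranks :: "nat \<Rightarrow> nat"
  first_core :: "nat \<Rightarrow> nat \<Rightarrow> real"
  mid_core :: "nat \<Rightarrow> nat \<Rightarrow> nat \<Rightarrow> nat \<Rightarrow> real"
  last_core :: "nat \<Rightarrow> nat \<Rightarrow> real"

definition valid_network :: "tensor_network \<Rightarrow> bool" where
  "valid_network v \<longleftrightarrow> 1 \<le> depth v \<and> (\<forall>\<nu>\<in>{1..depth v}. 1 \<le> ranks v \<nu>)"

definition contraction ::
    "nat \<Rightarrow> (nat \<Rightarrow> real poly) \<Rightarrow> tensor_network \<Rightarrow> (nat \<Rightarrow> nat) \<Rightarrow> real \<Rightarrow> real" where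
  "contraction m \<phi> v i y =
     (\<Sum>k \<in> (\<Pi>\<^sub>E \<nu>\<in>{1..depth v}. {1..ranks v \<nu>}). \<Sum>q=1..m+1.
        first_core v (i 1) (k 1)
        * (\<Prod>\<nu>=2..depth v. mid_core v \<nu> (i \<nu>) (k (\<nu> - 1)) (k \<nu>))
        * last_core v (k (depth v)) q * poly (\<phi> q) y)"

definition realizes ::
    "nat \<Rightarrow> nat \<Rightarrow> (nat \<Rightarrow> real poly) \<Rightarrow> tensor_network \<Rightarrow> (real \<Rightarrow> real) \<Rightarrow> bool" where
  "realizes b m \<phi> v f \<longleftrightarrow>
     (\<forall>i \<in> {1..depth v} \<rightarrow> {0..<b}. \<forall>y \<in> {0..<1}.
        tensorization b (depth v) f i y = contraction m \<phi> v i y)"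

definition compl_N :: "tensor_network \<Rightarrow> nat" where
  "compl_N v = (\<Sum>\<nu>=1..depth v. ranks v \<nu>)"

definition compl_C :: "nat \<Rightarrow> nat \<Rightarrow> tensor_network \<Rightarrow> nat" where
  "compl_C b m v =
     b * ranks v 1 + b * (\<Sum>k=2..depth v. ranks v (k - 1) * ranks v k) + ranks v (depth v) * (m + 1)"

definition compl_S :: "nat \<Rightarrow> nat \<Rightarrow> tensor_network \<Rightarrow> nat" where
  "compl_S b m v =
     card {(i, k) \<in> {0..<b} \<times> {1..ranks v 1}. first_core v i k \<noteq> 0}
     + (\<Sum>\<nu>=2..depth v.
          card {(i, k, l) \<in> {0..<b} \<times> {1..ranks v (\<nu> - 1)} \<times> {1..ranks v \<nu>}.
                  mid_core v \<nu> i k l \<noteq> 0})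
     + card {(k, q) \<in> {1..ranks v (depth v)} \<times> {1..m+1}. last_core v k q \<noteq> 0}"

definition approx_set ::
    "nat \<Rightarrow> nat \<Rightarrow> (nat \<Rightarrow> real poly) \<Rightarrow> (tensor_network \<Rightarrow> nat) \<Rightarrow> nat \<Rightarrow> (real \<Rightarrow> real) set" where
  "approx_set b m \<phi> cmp n =
     {g. (\<forall>x\<in>{0..<1}. g x = 0) \<or>
         (\<exists>v. valid_network v \<and> realizes b m \<phi> v g \<and> cmp v \<le> n)}"

text \<open>
  The library's \<open>esssup\<close> is \<open>\<infinity>\<close> for functions that are not measurable (here: on \<open>[0,1)\<close>).
\<close>

definition Linf_norm :: "(real \<Rightarrow> real) \<Rightarrow> ennreal" where
  "Linf_norm g = esssup (lebesgue_on {0..<1}) (\<lambda>x. ennreal \<bar>g x\<bar>)"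

definition best_error :: "(real \<Rightarrow> real) set \<Rightarrow> (real \<Rightarrow> real) \<Rightarrow> ennreal" where
  "best_error \<Phi> f = (INF g\<in>\<Phi>. Linf_norm (\<lambda>x. f x - g x))"

definition E_N :: "nat \<Rightarrow> nat \<Rightarrow> (nat \<Rightarrow> real poly) \<Rightarrow> nat \<Rightarrow> (real \<Rightarrow> real) \<Rightarrow> ennreal" where
  "E_N b m \<phi> n f = best_error (approx_set b m \<phi> compl_N n) f"

definition E_C :: "nat \<Rightarrow> nat \<Rightarrow> (nat \<Rightarrow> real poly) \<Rightarrow> nat \<Rightarrow> (real \<Rightarrow> real) \<Rightarrow> ennreal" where
  "E_C b m \<phi> n f = best_error (approx_set b m \<phi> (compl_C b m) n) f"

definition E_S :: "nat \<Rightarrow> nat \<Rightarrow> (nat \<Rightarrow> real poly) \<Rightarrow> nat \<Rightarrow> (real \<Rightarrow> real) \<Rightarrow> ennreal" where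
  "E_S b m \<phi> n f = best_error (approx_set b m \<phi> (compl_S b m) n) f"

end

theory Submission
  imports Defs "HOL-Complex_Analysis.Cauchy_Integral_Formula"
begin

text \<open>
  The approximants are piecewise constant. Compactness of \<open>[0,1]\<close> gives a common lower bound \<open>r\<close> for
  the radius of convergence of \<open>F\<close> at its points, so there is a fixed level \<open>s\<close> at which the Taylor
  series of \<open>F\<close> at the left endpoint of each of the \<open>b ^ s\<close> cells converges on that cell at least as
  fast as a geometric series of ratio \<open>1/2\<close>. Truncating these series to \<open>q\<close> terms and sampling the
  resulting piecewise polynomial at the left endpoints of the cells of level \<open>s + q\<close> gives a function
  with error at most \<open>C / 2 ^ q\<close> (\<open>sampled_taylor_error\<close>): the Taylor remainder and the sampling step
  \<open>b ^ -(s + q)\<close> both decay geometrically in \<open>q\<close>. Working on fixed cells replaces a global polynomial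
  approximation, which would need an ellipse inside \<open>D\<close>, by Cauchy's inequality on small discs.

  Such a function is cheap for a tensor network (\<open>sampled_pw_poly_network\<close>). Reading the digits of
  \<open>x\<close> one after the other, it suffices to remember in which of the \<open>b ^ s\<close> cells \<open>x\<close> lies and the
  powers below \<open>q\<close> of the offset from its left endpoint, and each new digit acts linearly on this
  vector of length \<open>b ^ s * q\<close>. Being constant on the finest cells, the function requires of the
  last core only an expansion of the constant 1 in the basis \<open>\<phi>\<close>.

  Depth \<open>s + q\<close> and rank \<open>b ^ s * q\<close> amount to \<open>O(q\<^sup>2)\<close> neurons and \<open>O(q ^ 3)\<close> core entries. With a
  budget \<open>n\<close> one can therefore afford \<open>q\<close> proportional to \<open>n powr (1/2)\<close>, respectively
  \<open>n powr (1/3)\<close>, and the error \<open>C / 2 ^ q\<close> turns into the stated rates. Finally, the number of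
  non-zero entries is at most the number of entries, hence \<open>E_S \<le> E_C\<close>.
\<close>

section \<open>Networks from linear recursions over the digits\<close>

text \<open>
  The sum over all index tuples is a product of matrices applied to a vector; evaluating it from the
  left leads to the partial products \<open>V \<nu>\<close>. The weight \<open>X\<close> on the last index is arbitrary so that
  the induction can absorb the next matrix into it.
\<close>

lemma sum_PiE_chain:
  fixes first :: "nat \<Rightarrow> 'a::comm_semiring_1" and V :: "nat \<Rightarrow> nat \<Rightarrow> 'a"
  assumes "1 \<le> d"
    and first: "\<And>a. a \<in> A 1 \<Longrightarrow> V 1 a = first a"
    and step: "\<And>\<nu> a. \<lbrakk>1 \<le> \<nu>; \<nu> < d; a \<in> A (Suc \<nu>)\<rbrakk> \<Longrightarrow>
                 V (Suc \<nu>) a = (\<Sum>a'\<in>A \<nu>. V \<nu> a' * mid (Suc \<nu>) a' a)"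
  shows "(\<Sum>k\<in>PiE {1..d} A. first (k 1) * (\<Prod>\<nu>=2..d. mid \<nu> (k (\<nu> - 1)) (k \<nu>)) * X (k d))
         = (\<Sum>a\<in>A d. V d a * X a)"
  using assms(1) step
proof (induction d arbitrary: X rule: nat_induct_at_least)
  case base
  have "PiE {1..1} A = (\<lambda>(y, g). g((1::nat) := y)) ` (A 1 \<times> {\<lambda>_. undefined})"
    using PiE_insert_eq[of "1::nat" "{}" A] by simp
  moreover have "inj_on (\<lambda>(y, g). g((1::nat) := y)) (A 1 \<times> {\<lambda>_. undefined})"
    using inj_combinator[of "1::nat" "{}" A] by (simp del: One_nat_def)
  ultimately show ?case
    using first by (simp add: sum.reindex sum.cartesian_product' case_prod_unfold)
next
  case (Suc d)
  have ins: "{1..Suc d} = insert (Suc d) {1..d}" and ins2: "{2..Suc d} = insert (Suc d) {2..d}"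
    using \<open>1 \<le> d\<close> by auto
  have "(\<Sum>k\<in>PiE {1..Suc d} A. first (k 1) * (\<Prod>\<nu>=2..Suc d. mid \<nu> (k (\<nu> - 1)) (k \<nu>)) * X (k (Suc d)))
     = (\<Sum>(a, k)\<in>A (Suc d) \<times> PiE {1..d} A. first (k 1) * (\<Prod>\<nu>=2..d. mid \<nu> (k (\<nu> - 1)) (k \<nu>))
           * (mid (Suc d) (k d) a * X a))"
    unfolding ins PiE_insert_eq
  proof (subst sum.reindex, rule inj_combinator, simp, intro sum.cong refl, clarify)
    fix a k
    have "(\<Prod>\<nu>=2..Suc d. mid \<nu> ((k(Suc d := a)) (\<nu> - 1)) ((k(Suc d := a)) \<nu>))
        = mid (Suc d) (k d) a * (\<Prod>\<nu>=2..d. mid \<nu> (k (\<nu> - 1)) (k \<nu>))"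
      unfolding ins2 by (subst prod.insert) (auto intro!: prod.cong arg_cong2[where f="(*)"])
    then show "((\<lambda>k. first (k 1) * (\<Prod>\<nu>=2..Suc d. mid \<nu> (k (\<nu> - 1)) (k \<nu>)) * X (k (Suc d)))
            \<circ> (\<lambda>(y, g). g(Suc d := y))) (a, k)
         = first (k 1) * (\<Prod>\<nu>=2..d. mid \<nu> (k (\<nu> - 1)) (k \<nu>)) * (mid (Suc d) (k d) a * X a)"
      using \<open>1 \<le> d\<close> by (simp add: mult_ac)
  qed
  also have "\<dots> = (\<Sum>a\<in>A (Suc d). \<Sum>k\<in>PiE {1..d} A.
       first (k 1) * (\<Prod>\<nu>=2..d. mid \<nu> (k (\<nu> - 1)) (k \<nu>)) * (mid (Suc d) (k d) a * X a))"
    by (simp add: sum.cartesian_product)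
  also have "\<dots> = (\<Sum>a\<in>A (Suc d). \<Sum>a'\<in>A d. V d a' * (mid (Suc d) a' a * X a))"
    by (intro sum.cong refl Suc.IH Suc.prems) auto
  also have "\<dots> = (\<Sum>a\<in>A (Suc d). V (Suc d) a * X a)"
    using \<open>1 \<le> d\<close> by (intro sum.cong refl) (simp add: Suc.prems sum_distrib_right mult.assoc)
  finally show ?case .
qed

lemma poly_basis_one:
  assumes "is_poly_basis m \<phi>"
  obtains c where "\<And>y. (\<Sum>q=1..m+1. c q * poly (\<phi> q) y) = 1"
proof -
  interpret module "smult :: real \<Rightarrow> real poly \<Rightarrow> real poly"
    by unfold_locales (auto simp: smult_add_right smult_add_left)
  have "1 \<in> span (\<phi> ` {1..m+1})"
    using assms by (simp add: is_poly_basis_def)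
  then obtain u where "1 = (\<Sum>v\<in>\<phi> ` {1..m+1}. smult (u v) v)"
    by (subst (asm) span_finite) auto
  also have "\<dots> = (\<Sum>q=1..m+1. smult (u (\<phi> q)) (\<phi> q))"
    using assms by (subst sum.reindex) (auto simp: is_poly_basis_def)
  finally have *: "1 = (\<Sum>q=1..m+1. smult (u (\<phi> q)) (\<phi> q))" .
  have "(\<Sum>q=1..m+1. u (\<phi> q) * poly (\<phi> q) y) = 1" for y
    using arg_cong[OF *, of "\<lambda>p. poly p y"] by (simp add: poly_sum)
  then show thesis by (rule that)
qed

text \<open>
  A function that is constant on the cells of level \<open>d\<close> is realized as soon as its value is a linear
  functional of a state vector \<open>W\<close> which each new digit transforms linearly. The states are indexed
  by an arbitrary finite set, so that an index may be a pair; its size is the rank at every level.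
\<close>

lemma network_of_recursion:
  fixes W :: "(nat \<Rightarrow> nat) \<Rightarrow> nat \<Rightarrow> 'k \<Rightarrow> real" and T :: "nat \<Rightarrow> nat \<Rightarrow> 'k \<Rightarrow> 'k \<Rightarrow> real"
  assumes basis: "is_poly_basis m \<phi>" and "1 \<le> d" and "finite K" "K \<noteq> {}"
    and init: "\<And>i k. k \<in> K \<Longrightarrow> W i 0 k = w0 k"
    and step: "\<And>i \<nu> k. \<lbrakk>i \<in> {1..d} \<rightarrow> {0..<b}; \<nu> < d; k \<in> K\<rbrakk> \<Longrightarrow>
                 W i (Suc \<nu>) k = (\<Sum>k'\<in>K. W i \<nu> k' * T (Suc \<nu>) (i (Suc \<nu>)) k' k)"
    and val: "\<And>i y. \<lbrakk>i \<in> {1..d} \<rightarrow> {0..<b}; y \<in> {0..<1}\<rbrakk> \<Longrightarrow>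
                 tensorization b d g i y = (\<Sum>k\<in>K. W i d k * u k)"
  shows "\<exists>v. valid_network v \<and> realizes b m \<phi> v g \<and> depth v = d \<and> (\<forall>\<nu>. ranks v \<nu> = card K)"
proof -
  obtain c where c: "\<And>y. (\<Sum>q=1..m+1. c q * poly (\<phi> q) y) = 1"
    using poly_basis_one[OF basis] by blast
  obtain h where h: "bij_betw h {1..card K} K"
    using ex_bij_betw_nat_finite_1[OF \<open>finite K\<close>] by blast
  have hK: "h a \<in> K" if "a \<in> {1..card K}" for a
    using h that by (auto simp: bij_betw_def)
  \<comment> \<open>The recursion starts before the first digit, a network at it: the first core merges both.\<close>
  define first where "first = (\<lambda>\<iota> a. \<Sum>k'\<in>K. w0 k' * T 1 \<iota> k' (h a))"
  define v where "v = \<lparr>depth = d, ranks = (\<lambda>_. card K), first_core = first,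
    mid_core = (\<lambda>\<nu> \<iota> a a'. T \<nu> \<iota> (h a) (h a')), last_core = (\<lambda>a q. u (h a) * c q)\<rparr>"
  have "card K \<ge> 1"
    using assms by (simp add: Suc_le_eq card_gt_0_iff)
  then have "valid_network v"
    using \<open>1 \<le> d\<close> by (simp add: valid_network_def v_def)
  moreover have "realizes b m \<phi> v g"
    unfolding realizes_def
  proof (intro ballI)
    fix i :: "nat \<Rightarrow> nat" and y :: real
    assume "i \<in> {1..depth v} \<rightarrow> {0..<b}" and y: "y \<in> {0..<1}"
    then have i: "i \<in> {1..d} \<rightarrow> {0..<b}" by (simp add: v_def)
    have "contraction m \<phi> v i y
      = (\<Sum>k\<in>PiE {1..d} (\<lambda>_. {1..card K}). first (i 1) (k 1)
           * (\<Prod>\<nu>=2..d. T \<nu> (i \<nu>) (h (k (\<nu> - 1))) (h (k \<nu>))) * u (h (k d)))"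
      unfolding contraction_def v_def tensor_network.simps
    proof (intro sum.cong refl)
      fix k
      let ?P = "first (i 1) (k 1) * (\<Prod>\<nu>=2..d. T \<nu> (i \<nu>) (h (k (\<nu> - 1))) (h (k \<nu>)))"
      have "(\<Sum>q=1..m+1. ?P * (u (h (k d)) * c q) * poly (\<phi> q) y)
          = ?P * u (h (k d)) * (\<Sum>q=1..m+1. c q * poly (\<phi> q) y)"
        unfolding sum_distrib_left by (intro sum.cong refl) (simp only: mult_ac)
      then show "(\<Sum>q=1..m+1. ?P * (u (h (k d)) * c q) * poly (\<phi> q) y) = ?P * u (h (k d))"
        by (simp only: c mult_1_right)
    qed
    also have "\<dots> = (\<Sum>a\<in>{1..card K}. W i d (h a) * u (h a))"
    proof (rule sum_PiE_chain[where V = "\<lambda>\<nu> a. W i \<nu> (h a)" and X = "\<lambda>a. u (h a)"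
            and A = "\<lambda>_. {1..card K}" and mid = "\<lambda>\<nu> a' a. T \<nu> (i \<nu>) (h a') (h a)"])
      show "W i 1 (h a) = first (i 1) a" if "a \<in> {1..card K}" for a
        using step[of i 0 "h a"] \<open>1 \<le> d\<close> i hK[OF that] by (simp add: first_def init)
      show "W i (Suc \<nu>) (h a) = (\<Sum>a'\<in>{1..card K}. W i \<nu> (h a') * T (Suc \<nu>) (i (Suc \<nu>)) (h a') (h a))"
        if "\<nu> < d" "a \<in> {1..card K}" for \<nu> a
        using step[OF i that(1) hK[OF that(2)]]
          sum.reindex_bij_betw[OF h, of "\<lambda>k'. W i \<nu> k' * T (Suc \<nu>) (i (Suc \<nu>)) k' (h a)"] by simp
    qed (use \<open>1 \<le> d\<close> in auto)
    also have "\<dots> = (\<Sum>k\<in>K. W i d k * u k)"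
      using h by (rule sum.reindex_bij_betw)
    finally show "tensorization b (depth v) g i y = contraction m \<phi> v i y"
      using val[OF i y] by (simp add: v_def)
  qed
  ultimately show ?thesis
    by (intro exI[of _ v]) (simp add: v_def)
qed

section \<open>Piecewise polynomials sampled on a grid\<close>

fun prefix_num :: "nat \<Rightarrow> (nat \<Rightarrow> nat) \<Rightarrow> nat \<Rightarrow> nat" where
  "prefix_num b i 0 = 0"
| "prefix_num b i (Suc \<nu>) = b * prefix_num b i \<nu> + i (Suc \<nu>)"

lemma sum_digits_eq_prefix_num:
  "b > 0 \<Longrightarrow> (\<Sum>k=1..\<nu>. real (i k) / real b ^ k) = real (prefix_num b i \<nu>) / real b ^ \<nu>"
  by (induction \<nu>) (simp_all add: field_simps)

lemma prefix_num_less: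
  "i \<in> {1..\<nu>} \<rightarrow> {0..<b} \<Longrightarrow> prefix_num b i \<nu> < b ^ \<nu>"
proof (induction \<nu>)
  case (Suc \<nu>)
  have "i \<in> {1..\<nu>} \<rightarrow> {0..<b}" using Suc.prems by (auto simp: Pi_iff)
  then have "prefix_num b i \<nu> + 1 \<le> b ^ \<nu>" using Suc.IH by simp
  then have "b * (prefix_num b i \<nu> + 1) \<le> b * b ^ \<nu>" by (rule mult_le_mono2)
  moreover have "i (Suc \<nu>) < b" using Suc.prems by (auto simp: Pi_iff)
  ultimately show ?case by simp
qed simp

text \<open>
  Division by \<open>b ^ t\<close> drops the last \<open>t\<close> digits. This is how the coarse cell containing a fine cell is
  recovered from the index of the fine cell.
\<close>

lemma prefix_num_div:
  "i \<in> {1..s+t} \<rightarrow> {0..<b} \<Longrightarrow> prefix_num b i (s + t) div b ^ t = prefix_num b i s"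
proof (induction t)
  case (Suc t)
  have "i (Suc (s + t)) < b" "i \<in> {1..s+t} \<rightarrow> {0..<b}"
    using Suc.prems by (auto simp: Pi_iff)
  then show ?case
    using Suc.IH by (simp add: div_mult2_eq)
qed simp

text \<open>
  On each of the \<open>b ^ s\<close> cells of level \<open>s\<close> a polynomial of degree below \<open>q\<close> in the offset from the
  left endpoint of the cell, sampled at the left endpoints of the cells of level \<open>s + t\<close>.
\<close>

definition sampled_pw_poly ::
    "nat \<Rightarrow> nat \<Rightarrow> nat \<Rightarrow> nat \<Rightarrow> (nat \<Rightarrow> nat \<Rightarrow> real) \<Rightarrow> real \<Rightarrow> real" where
  "sampled_pw_poly b s t q a x =
     (let N = nat \<lfloor>real b ^ (s + t) * x\<rfloor>; j = N div b ^ t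
      in \<Sum>l<q. a j l * (real N / real b ^ (s + t) - real j / real b ^ s) ^ l)"

text \<open>
  The state is indexed by pairs \<open>(j, l)\<close>: it is the indicator of the current cell \<open>j\<close> of level at
  most \<open>s\<close> times the power \<open>l\<close> of the offset from its left endpoint. The digits up to \<open>s\<close> update the
  cell. A later digit \<open>c\<close> at position \<open>\<nu>\<close> adds \<open>c / b ^ \<nu>\<close> to the offset, and by the binomial theorem
  the powers below \<open>q\<close> of the new offset are linear combinations of those of the old one.
\<close>

lemma sampled_pw_poly_network:
  assumes b: "2 \<le> b" and basis: "is_poly_basis m \<phi>" and "1 \<le> q" "1 \<le> s + t"
  shows "\<exists>v. valid_network v \<and> realizes b m \<phi> v (sampled_pw_poly b s t q a) \<and> depth v = s + t
             \<and> (\<forall>\<nu>. ranks v \<nu> = b ^ s * q)"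
proof -
  define K where "K = {..<b ^ s} \<times> {..<q}"
  define off where "off = (\<lambda>i \<nu>. real (prefix_num b i \<nu>) / real b ^ \<nu>
      - real (prefix_num b i (min \<nu> s)) / real b ^ min \<nu> s)"
  define W where "W = (\<lambda>i \<nu> (j, l). of_bool (j = prefix_num b i (min \<nu> s)) * off i \<nu> ^ l)"
  define w0 where "w0 = (\<lambda>(j::nat, l). of_bool (j = 0) * (0::real) ^ l)"
  define e where "e = (\<lambda>\<nu> c. if \<nu> \<le> s then 0 else real c / real b ^ \<nu>)"
  define nxt where "nxt = (\<lambda>\<nu> c j. if \<nu> \<le> s then b * j + c else j)"
  define T where "T = (\<lambda>\<nu> c (j', l') (j, l). of_bool (j = nxt \<nu> c j')
      * (real (l choose l') * e \<nu> c ^ (l - l')))"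
  define u where "u = (\<lambda>(j, l). a j l)"
  have "\<exists>v. valid_network v \<and> realizes b m \<phi> v (sampled_pw_poly b s t q a) \<and> depth v = s + t
             \<and> (\<forall>\<nu>. ranks v \<nu> = card K)"
  proof (rule network_of_recursion[OF basis, where W = W and T = T and ?w0.0 = w0 and u = u])
    show "finite K" "K \<noteq> {}"
      using b \<open>1 \<le> q\<close> by (auto simp: K_def lessThan_empty_iff)
    show "W i 0 k = w0 k" for i k
      by (cases k) (simp add: W_def w0_def off_def)
    show "1 \<le> s + t" by fact
  next
    fix i \<nu> and k :: "nat \<times> nat"
    assume i: "i \<in> {1..s+t} \<rightarrow> {0..<b}" and \<nu>: "\<nu> < s + t" and "k \<in> K"
    then obtain j l where k: "k = (j, l)" and l: "l < q" by (auto simp: K_def)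
    let ?J = "prefix_num b i (min \<nu> s)" and ?c = "i (Suc \<nu>)"
    have "prefix_num b i (min \<nu> s) < b ^ min \<nu> s"
      using i \<nu> by (intro prefix_num_less) (auto simp: Pi_iff)
    also have "\<dots> \<le> b ^ s" using b by (intro power_increasing) auto
    finally have J: "?J < b ^ s" .
    have nxt: "nxt (Suc \<nu>) ?c ?J = prefix_num b i (min (Suc \<nu>) s)"
      by (auto simp: nxt_def min_def not_less_eq_eq le_antisym)
    have off: "off i (Suc \<nu>) = off i \<nu> + e (Suc \<nu>) ?c"
      using b by (auto simp: off_def e_def min_def field_simps dest: le_antisym)
    have "(\<Sum>k'\<in>K. W i \<nu> k' * T (Suc \<nu>) ?c k' k)
        = (\<Sum>j'<b ^ s. \<Sum>l'<q. of_bool (j' = ?J) * (off i \<nu> ^ l' * (of_bool (j = nxt (Suc \<nu>) ?c j')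
             * (real (l choose l') * e (Suc \<nu>) ?c ^ (l - l')))))"
      unfolding K_def k W_def T_def by (simp add: sum.cartesian_product case_prod_unfold mult_ac)
    also have "\<dots> = (\<Sum>j'<b ^ s. if j' = ?J then \<Sum>l'<q. off i \<nu> ^ l' * (of_bool (j = nxt (Suc \<nu>) ?c ?J)
             * (real (l choose l') * e (Suc \<nu>) ?c ^ (l - l'))) else 0)"
      by (intro sum.cong) auto
    also have "\<dots> = (\<Sum>l'<q. off i \<nu> ^ l' * (of_bool (j = nxt (Suc \<nu>) ?c ?J)
             * (real (l choose l') * e (Suc \<nu>) ?c ^ (l - l'))))"
      using J by simp
    also have "\<dots> = of_bool (j = nxt (Suc \<nu>) ?c ?J) *
        (\<Sum>l'<q. real (l choose l') * off i \<nu> ^ l' * e (Suc \<nu>) ?c ^ (l - l'))"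
      by (simp add: sum_distrib_left mult_ac)
    also have "(\<Sum>l'<q. real (l choose l') * off i \<nu> ^ l' * e (Suc \<nu>) ?c ^ (l - l'))
        = (\<Sum>l'\<le>l. real (l choose l') * off i \<nu> ^ l' * e (Suc \<nu>) ?c ^ (l - l'))"
      using l by (intro sum.mono_neutral_right) auto
    also have "\<dots> = off i (Suc \<nu>) ^ l"
      by (simp add: off binomial_ring)
    finally show "W i (Suc \<nu>) k = (\<Sum>k'\<in>K. W i \<nu> k' * T (Suc \<nu>) ?c k' k)"
      by (simp add: W_def k nxt)
  next
    fix i :: "nat \<Rightarrow> nat" and y :: real
    assume i: "i \<in> {1..s+t} \<rightarrow> {0..<b}" and y: "y \<in> {0..<1}"
    let ?J = "prefix_num b i (s + t)" and ?j = "prefix_num b i s"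
    have "real b ^ (s + t) * ((\<Sum>k=1..s+t. real (i k) / real b ^ k) + y / real b ^ (s + t)) = real ?J + y"
      using b by (subst sum_digits_eq_prefix_num) (simp_all add: field_simps)
    moreover have "\<lfloor>real ?J + y\<rfloor> = int ?J"
      using y by (intro floor_unique) auto
    ultimately have "tensorization b (s + t) (sampled_pw_poly b s t q a) i y
        = (\<Sum>l<q. a ?j l * (real ?J / real b ^ (s + t) - real ?j / real b ^ s) ^ l)"
      unfolding tensorization_def sampled_pw_poly_def by (simp add: prefix_num_div[OF i] Let_def)
    also have "\<dots> = (\<Sum>j'<b ^ s. if j' = ?j then \<Sum>l<q. off i (s + t) ^ l * a ?j l else 0)"
      using prefix_num_less[of i s b] i by (simp add: off_def mult_ac Pi_iff)
    also have "\<dots> = (\<Sum>j'<b ^ s. \<Sum>l<q. W i (s + t) (j', l) * u (j', l))"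
      by (intro sum.cong) (auto simp: W_def u_def)
    also have "\<dots> = (\<Sum>k\<in>K. W i (s + t) k * u k)"
      unfolding K_def by (simp add: sum.cartesian_product case_prod_unfold)
    finally show "tensorization b (s + t) (sampled_pw_poly b s t q a) i y
        = (\<Sum>k\<in>K. W i (s + t) k * u k)" .
  qed
  then show ?thesis by (simp add: K_def card_cartesian_product)
qed

section \<open>Local Taylor approximation\<close>

text \<open>
  The closed discs of radius \<open>r\<close> around the points of \<open>[0,1]\<close> fill a compact subset of \<open>D\<close>, on which
  \<open>F\<close> is bounded by some \<open>M\<close>. Cauchy's inequality then controls all Taylor coefficients uniformly in
  the centre, and half the radius makes the remainder a geometric tail.
\<close>

lemma uniform_taylor_bounds:
  assumes D: "open D" "complex_of_real ` {0..1} \<subseteq> D" and F: "F analytic_on D"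
  obtains r M :: real where "r > 0" "M > 0"
    and "\<And>x. x \<in> {0..1} \<Longrightarrow> cmod (F (of_real x)) \<le> M"
    and "\<And>x y. \<lbrakk>x \<in> {0..1}; y \<in> {0..1}\<rbrakk> \<Longrightarrow>
           cmod (F (of_real x) - F (of_real y)) \<le> M / r * \<bar>x - y\<bar>"
    and "\<And>x h q. \<lbrakk>x \<in> {0..1}; \<bar>h\<bar> \<le> r / 2\<rbrakk> \<Longrightarrow>
           cmod (F (of_real (x + h))
             - (\<Sum>l<q. (deriv ^^ l) F (of_real x) / fact l * of_real h ^ l)) \<le> 2 * M / 2 ^ q"
proof -
  define S where "S = complex_of_real ` {0..1}"
  have "compact S"
    unfolding S_def by (intro compact_continuous_image continuous_intros) auto
  then obtain r where r: "r > 0" and rD: "(\<Union>x\<in>S. cball x r) \<subseteq> D"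
    using compact_subset_open_imp_cball_epsilon_subset[of S D] D unfolding S_def by blast
  have holD: "F holomorphic_on D"
    using F by (rule analytic_imp_holomorphic)
  define U where "U = (\<Union>x\<in>S. cball x r)"
  have "compact U"
    unfolding U_def using \<open>compact S\<close> by (rule compact_minkowski_sum_cball)
  have U: "z \<in> U" if "x \<in> S" "z \<in> cball x r" for x z
    unfolding U_def using that by blast
  have "U \<subseteq> D"
    unfolding U_def by (rule rD)
  then have "compact (F ` U)"
    using continuous_on_subset[OF holomorphic_on_imp_continuous_on[OF holD]] \<open>compact U\<close>
    by (intro compact_continuous_image)
  then obtain M where M: "M > 0" and MU: "\<And>z. z \<in> U \<Longrightarrow> cmod (F z) \<le> M"
    using compact_imp_bounded bounded_pos by (metis image_eqI)
  have hol: "F holomorphic_on ball z r" and cont: "continuous_on (cball z r) F" if "z \<in> S" for z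
  proof -
    have "cball z r \<subseteq> D" using rD that by auto
    then have "F holomorphic_on cball z r" using holD holomorphic_on_subset by blast
    then show "F holomorphic_on ball z r" "continuous_on (cball z r) F"
      using holomorphic_on_subset holomorphic_on_imp_continuous_on ball_subset_cball by blast+
  qed
  have cauchy: "cmod ((deriv ^^ n) F z) \<le> fact n * M / r ^ n" if "z \<in> S" for z n
    using U that
    by (intro Cauchy_inequality hol cont r MU that) (auto simp: dist_norm)
  show thesis
  proof (rule that[OF r M])
    show "cmod (F (of_real x)) \<le> M" if "x \<in> {0..1}" for x
      using that r by (intro MU U[of "of_real x"]) (auto simp: S_def)
  next
    fix x y :: real assume xy: "x \<in> {0..1}" "y \<in> {0..1}"
    have "convex S"
      unfolding S_def
      by (rule convex_linear_image[OF bounded_linear.linear[OF bounded_linear_of_real]])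
        (rule convex_real_interval)
    moreover have "(F has_field_derivative deriv F z) (at z within S)" if "z \<in> S" for z
    proof (rule has_field_derivative_at_within, rule holomorphic_derivI[OF holD D(1)])
      show "z \<in> D" using that D(2) by (auto simp: S_def)
    qed
    moreover have "cmod (deriv F z) \<le> M / r" if "z \<in> S" for z
      using cauchy[OF that, of 1] by simp
    ultimately have "cmod (F (of_real x) - F (of_real y)) \<le> M / r * cmod (of_real x - of_real y)"
      by (rule field_differentiable_bound) (use xy in \<open>auto simp: S_def\<close>)
    then show "cmod (F (of_real x) - F (of_real y)) \<le> M / r * \<bar>x - y\<bar>"
      by (metis norm_of_real of_real_diff)
  next
    fix x h :: real and q
    assume x: "x \<in> {0..1}" and h: "\<bar>h\<bar> \<le> r / 2"
    define \<tau> where "\<tau> = (\<lambda>l. (deriv ^^ l) F (of_real x) / fact l * of_real h ^ l)"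
    have xS: "complex_of_real x \<in> S" using x by (simp add: S_def)
    have "complex_of_real (x + h) \<in> ball (of_real x) r"
      using h r by (simp add: dist_norm)
    from holomorphic_power_series[OF hol[OF xS] this]
    have "\<tau> sums F (of_real (x + h))" by (simp add: \<tau>_def)
    then have "(\<lambda>l. \<tau> (l + q)) sums (F (of_real (x + h)) - (\<Sum>l<q. \<tau> l))"
      by (rule sums_split_initial_segment)
    moreover have "cmod (\<tau> (l + q)) \<le> M / 2 ^ q * (1/2) ^ l" for l
    proof -
      have "cmod (\<tau> n) \<le> M / r ^ n * (r / 2) ^ n" for n
        unfolding \<tau>_def norm_mult norm_divide norm_power norm_of_real norm_fact
        using cauchy[OF xS, of n] h r M
        by (intro mult_mono power_mono) (auto simp: field_simps)
      from this[of "l + q"] show ?thesis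
        using r by (simp add: power_add power_divide mult.commute)
    qed
    moreover have "(\<lambda>l. M / 2 ^ q * (1/2) ^ l) sums (M / 2 ^ q * 2)"
      using geometric_sums[of "1/2::real"] by (intro sums_mult) simp
    ultimately show "cmod (F (of_real (x + h)) - (\<Sum>l<q. \<tau> l)) \<le> 2 * M / 2 ^ q"
      using norm_suminf_le[of "\<lambda>l. \<tau> (l + q)" "\<lambda>l. M / 2 ^ q * (1/2) ^ l"]
      by (simp add: sums_iff mult.commute)
  qed
qed

text \<open>
  Once \<open>b ^ s\<close> exceeds twice the inverse of the radius of convergence, the Taylor polynomials at the
  left endpoints of the fixed cells of level \<open>s\<close> converge geometrically on these cells. Sampling them
  at level \<open>s + q\<close> costs only another \<open>b ^ -(s + q)\<close>, because the Lipschitz bound is used for \<open>f\<close>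
  and not for the polynomials.
\<close>

lemma sampled_taylor_error:
  assumes b: "2 \<le> b" and D: "open D" "complex_of_real ` {0..1} \<subseteq> D" and F: "F analytic_on D"
    and f: "\<And>x. x \<in> {0..<1} \<Longrightarrow> F (complex_of_real x) = complex_of_real (f x)"
  obtains s a C where "C > 0" "\<And>x. x \<in> {0..<1} \<Longrightarrow> \<bar>f x\<bar> \<le> C"
    and "\<And>q x. x \<in> {0..<1} \<Longrightarrow> \<bar>f x - sampled_pw_poly b s q q a x\<bar> \<le> C / 2 ^ q"
proof -
  obtain r M where r: "r > 0" and M: "M > 0"
    and FM: "\<And>x. x \<in> {0..1} \<Longrightarrow> cmod (F (of_real x)) \<le> M"
    and lip: "\<And>x y. \<lbrakk>x \<in> {0..1}; y \<in> {0..1}\<rbrakk> \<Longrightarrow>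
           cmod (F (of_real x) - F (of_real y)) \<le> M / r * \<bar>x - y\<bar>"
    and taylor: "\<And>x h q. \<lbrakk>x \<in> {0..1}; \<bar>h\<bar> \<le> r / 2\<rbrakk> \<Longrightarrow>
           cmod (F (of_real (x + h))
             - (\<Sum>l<q. (deriv ^^ l) F (of_real x) / fact l * of_real h ^ l)) \<le> 2 * M / 2 ^ q"
    by (rule uniform_taylor_bounds[OF D F]) (rule that)
  have b0: "real b > 0" "real b > 1" using b by auto
  obtain s where s: "2 / r < real b ^ s"
    using real_arch_pow[OF b0(2)] by blast
  define a where "a = (\<lambda>j l. Re ((deriv ^^ l) F (of_real (real j / real b ^ s)) / fact l))"
  show thesis
  proof (rule that)
    show "2 * M + M / r > 0" using r M by (simp add: add_pos_pos)
    show "\<bar>f x\<bar> \<le> 2 * M + M / r" if "x \<in> {0..<1}" for x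
    proof -
      have "\<bar>f x\<bar> \<le> M" using FM[of x] f[OF that] that by simp
      moreover have "M / r > 0" using r M by simp
      ultimately show ?thesis using M by linarith
    qed
  next
    fix q and x :: real
    assume x: "x \<in> {0..<1}"
    define B where "B = real b ^ (s + q)"
    have B: "B > 0" using b0 by (simp add: B_def)
    define N where "N = nat \<lfloor>B * x\<rfloor>"
    define j where "j = N div b ^ q"
    define z where "z = real N / B"
    define w where "w = real j / real b ^ s"
    have "real N = of_int \<lfloor>B * x\<rfloor>"
      using x B by (simp add: N_def)
    then have N: "real N \<le> B * x" "B * x < real N + 1"
      by linarith+
    then have zx: "z \<le> x" "x < z + 1 / B" "0 \<le> z"
      using B by (simp_all add: z_def field_simps)
    have "real j * real b ^ q \<le> real N"
      unfolding j_def by (metis div_times_less_eq_dividend of_nat_le_iff of_nat_mult of_nat_power)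
    then have wz: "w \<le> z"
      using b0 by (simp add: w_def z_def B_def power_add field_simps)
    have "N < (j + 1) * b ^ q"
      unfolding j_def using b by (simp add: dividend_less_div_times)
    then have "real N < (real j + 1) * real b ^ q"
      by (metis of_nat_1 of_nat_add of_nat_less_iff of_nat_mult of_nat_power)
    then have zw: "z < w + 1 / real b ^ s"
      using b0 by (simp add: w_def z_def B_def power_add field_simps)
    have "1 / real b ^ s < r / 2"
      using s r b0 by (simp add: field_simps)
    then have h: "\<bar>z - w\<bar> \<le> r / 2" using wz zw by simp
    have "0 \<le> w" using b0 by (simp add: w_def)
    then have w: "w \<in> {0..1}"
      using wz zx x by simp
    have z: "z \<in> {0..<1}" using zx x by auto
    have g: "sampled_pw_poly b s q q a x = (\<Sum>l<q. a j l * (z - w) ^ l)"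
      unfolding sampled_pw_poly_def Let_def z_def w_def j_def N_def B_def ..
    also have "\<dots> = Re (\<Sum>l<q. (deriv ^^ l) F (of_real w) / fact l * of_real (z - w) ^ l)"
      unfolding a_def w_def[symmetric] of_real_power[symmetric]
      by (simp only: Re_sum times_complex.sel Re_complex_of_real Im_complex_of_real
            mult_zero_right diff_zero)
    finally have "f z - sampled_pw_poly b s q q a x
        = Re (F (of_real z) - (\<Sum>l<q. (deriv ^^ l) F (of_real w) / fact l * of_real (z - w) ^ l))"
      using f[OF z] by simp
    then have "\<bar>f z - sampled_pw_poly b s q q a x\<bar> \<le> 2 * M / 2 ^ q"
      using taylor[OF w h, of q] abs_Re_le_cmod order_trans by fastforce
    moreover have "\<bar>f x - f z\<bar> \<le> M / r / 2 ^ q"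
    proof -
      have "f x - f z = Re (F (of_real x) - F (of_real z))"
        using f[OF x] f[OF z] by simp
      then have "\<bar>f x - f z\<bar> \<le> cmod (F (of_real x) - F (of_real z))"
        using abs_Re_le_cmod by metis
      also have "\<dots> \<le> M / r * \<bar>x - z\<bar>"
        using x z by (intro lip) auto
      also have "\<dots> \<le> M / r * (1 / 2 ^ q)"
      proof (rule mult_left_mono)
        have "(2::real) ^ q \<le> real b ^ q"
          using b by (intro power_mono) auto
        also have "\<dots> \<le> B"
          unfolding B_def using b0 by (intro power_increasing) auto
        finally have "1 / B \<le> 1 / 2 ^ q"
          by (intro divide_left_mono) (use B in auto)
        then show "\<bar>x - z\<bar> \<le> 1 / 2 ^ q" using zx by linarith
      qed (use r M in auto)
      finally show ?thesis by simp
    qed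
    ultimately show "\<bar>f x - sampled_pw_poly b s q q a x\<bar> \<le> (2 * M + M / r) / 2 ^ q"
      by (simp add: add_divide_distrib)
  qed
qed

section \<open>Approximation errors\<close>

lemma best_error_le:
  assumes "g \<in> \<Phi>" "(\<lambda>x. f x - g x) \<in> borel_measurable (lebesgue_on {0..<1})"
    and "\<And>x. x \<in> {0..<1} \<Longrightarrow> \<bar>f x - g x\<bar> \<le> c"
  shows "best_error \<Phi> f \<le> ennreal c"
proof -
  have "Linf_norm (\<lambda>x. f x - g x) \<le> ennreal c"
    unfolding Linf_norm_def
  proof (rule esssup_I)
    show "(\<lambda>x. ennreal \<bar>f x - g x\<bar>) \<in> borel_measurable (lebesgue_on {0..<1})"
      using assms(2) by measurable
    show "AE x in lebesgue_on {0..<1}. ennreal \<bar>f x - g x\<bar> \<le> ennreal c"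
      using assms(3) by (intro AE_I2) (auto intro: ennreal_leI)
  qed
  then show ?thesis
    unfolding best_error_def using assms(1) by (rule INF_lower2[rotated])
qed

text \<open>
  The essential supremum is infinite on non-measurable functions, so measurability is a real
  obligation here; it holds because the function factors through a floor.
\<close>

lemma sampled_pw_poly_measurable:
  "sampled_pw_poly b s t q a \<in> borel_measurable (lebesgue_on {0..<1})"
proof -
  define H where "H = (\<lambda>n::int. \<Sum>l<q. a (nat n div b ^ t) l
    * (real (nat n) / real b ^ (s + t) - real (nat n div b ^ t) / real b ^ s) ^ l)"
  have "(\<lambda>x. H \<lfloor>real b ^ (s + t) * x\<rfloor>) \<in> borel_measurable borel"
    by measurable
  moreover have "(\<lambda>x. H \<lfloor>real b ^ (s + t) * x\<rfloor>) = sampled_pw_poly b s t q a"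
    by (simp add: fun_eq_iff H_def sampled_pw_poly_def Let_def)
  ultimately have "sampled_pw_poly b s t q a \<in> borel_measurable borel"
    by simp
  then show ?thesis
    by (intro measurable_restrict_space1) (simp add: measurable_completion)
qed

lemma compl_S_le_compl_C: "compl_S b m v \<le> compl_C b m v"
proof -
  have "card {(i, k) \<in> {0..<b} \<times> {1..ranks v 1}. first_core v i k \<noteq> 0} \<le> b * ranks v 1"
    by (rule order_trans[OF card_mono[of "{0..<b} \<times> {1..ranks v 1}"]])
      (auto simp: card_cartesian_product)
  moreover have "card {(i, k, l) \<in> {0..<b} \<times> {1..ranks v (\<nu> - 1)} \<times> {1..ranks v \<nu>}.
      mid_core v \<nu> i k l \<noteq> 0} \<le> b * (ranks v (\<nu> - 1) * ranks v \<nu>)" for \<nu>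
    by (rule order_trans[OF card_mono[of "{0..<b} \<times> {1..ranks v (\<nu> - 1)} \<times> {1..ranks v \<nu>}"]])
      (auto simp: card_cartesian_product)
  moreover have "card {(k, q) \<in> {1..ranks v (depth v)} \<times> {1..m+1}. last_core v k q \<noteq> 0}
      \<le> ranks v (depth v) * (m + 1)"
    by (rule order_trans[OF card_mono[of "{1..ranks v (depth v)} \<times> {1..m+1}"]])
      (auto simp: card_cartesian_product)
  ultimately show ?thesis
    unfolding compl_S_def compl_C_def sum_distrib_left by (intro add_mono sum_mono) auto
qed

lemma E_S_le_E_C: "E_S b m \<phi> n f \<le> E_C b m \<phi> n f"
proof -
  have "approx_set b m \<phi> (compl_C b m) n \<subseteq> approx_set b m \<phi> (compl_S b m) n"
    unfolding approx_set_def using compl_S_le_compl_C order_trans by blast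
  then show ?thesis
    unfolding E_S_def E_C_def best_error_def by (rule INF_superset_mono) simp
qed

text \<open>
  The order is \<open>q = nat \<lfloor>x\<rfloor>\<close> for \<open>x = n powr (1/k) / c\<close>, which is affordable because
  \<open>c * x ^ k \<le> n\<close> for \<open>c \<ge> 1\<close>. Dividing by \<open>c\<close> and not by its \<open>k\<close>-th root makes the base
  \<open>2 powr (1 / c)\<close> independent of \<open>k\<close>; the factor 2 pays for the rounding.
\<close>

lemma budget_to_order:
  fixes c n k :: nat
  assumes "1 \<le> c" "1 \<le> n" "1 \<le> k"
  obtains q where "c * q ^ k \<le> n"
    and "1 / 2 ^ q \<le> 2 * (2 powr (1 / real c)) powr (- (real n powr (1 / real k)))"
proof -
  define x where "x = real n powr (1 / real k) / real c"
  define q where "q = nat \<lfloor>x\<rfloor>"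
  have "x \<ge> 0" by (simp add: x_def)
  then have "real q = of_int \<lfloor>x\<rfloor>" by (simp add: q_def)
  then have q: "real q \<le> x" "x < real q + 1" by linarith+
  show thesis
  proof (rule that)
    have "real c * real q ^ k \<le> real c * x ^ k"
      using q by (intro mult_left_mono power_mono) auto
    also have "x ^ k = real n / real c ^ k"
      using assms by (simp add: x_def power_divide powr_power)
    also have "real c * (real n / real c ^ k) \<le> real n"
    proof -
      have "real c \<le> real c ^ k" using assms by (intro self_le_power) auto
      then have "real c * real n \<le> real c ^ k * real n" by (intro mult_right_mono) auto
      then show ?thesis using assms by (simp add: field_simps)
    qed
    finally show "c * q ^ k \<le> n"
      by (metis of_nat_le_iff of_nat_mult of_nat_power)
    have "1 / 2 ^ q = (2::real) powr (- real q)"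
      by (simp add: powr_minus powr_realpow divide_inverse)
    also have "\<dots> \<le> 2 powr (1 - x)"
      using q by (intro powr_mono) auto
    also have "\<dots> = 2 * (2 powr (1 / real c)) powr (- (real n powr (1 / real k)))"
      by (simp add: powr_powr powr_diff powr_minus x_def divide_inverse mult.commute)
    finally show "1 / 2 ^ q \<le> 2 * (2 powr (1 / real c)) powr (- (real n powr (1 / real k)))" .
  qed
qed

text \<open>
  Uniform rank \<open>b ^ s * q\<close> and depth \<open>s + q\<close>, with \<open>s\<close> and \<open>b\<close> fixed: the sum of the ranks is
  quadratic in \<open>q\<close>, and the number of core entries, quadratic in the rank, is cubic.
\<close>

lemma sampled_pw_poly_in_approx_sets:
  fixes s :: nat
  assumes b: "2 \<le> b" and basis: "is_poly_basis m \<phi>" and q: "1 \<le> q"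
  defines "c \<equiv> (s + 1) * b ^ s + b * b ^ s + b * (s + 1) * (b ^ s * b ^ s) + b ^ s * (m + 1)"
  shows "sampled_pw_poly b s q q a \<in> approx_set b m \<phi> compl_N (c * q\<^sup>2)"
    and "sampled_pw_poly b s q q a \<in> approx_set b m \<phi> (compl_C b m) (c * q ^ 3)"
proof -
  obtain v where v: "valid_network v" "realizes b m \<phi> v (sampled_pw_poly b s q q a)"
      "depth v = s + q" "\<And>\<nu>. ranks v \<nu> = b ^ s * q"
    using sampled_pw_poly_network[OF b basis, of q s q a] q by auto
  have sq: "s + q \<le> (s + 1) * q" using q by (cases q) auto
  then have sq1: "s + q - 1 \<le> (s + 1) * q" by linarith
  have q3: "q \<le> q ^ 3" using q by (intro self_le_power) auto
  have "compl_N v = (s + q) * (b ^ s * q)"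
    by (simp add: compl_N_def v)
  also have "\<dots> \<le> ((s + 1) * q) * (b ^ s * q)"
    using sq by (rule mult_le_mono1)
  also have "\<dots> = ((s + 1) * b ^ s) * q\<^sup>2"
    by (simp add: power2_eq_square algebra_simps)
  also have "\<dots> \<le> c * q\<^sup>2"
    unfolding c_def by (intro mult_le_mono1) simp
  finally show "sampled_pw_poly b s q q a \<in> approx_set b m \<phi> compl_N (c * q\<^sup>2)"
    unfolding approx_set_def using v by blast
  have "compl_C b m v = b * (b ^ s * q) + b * ((s + q - 1) * (b ^ s * q * (b ^ s * q)))
      + b ^ s * q * (m + 1)"
    using q by (simp add: compl_C_def v)
  also have "\<dots> \<le> b * (b ^ s * q ^ 3) + b * ((s + 1) * q * (b ^ s * q * (b ^ s * q)))
      + b ^ s * q ^ 3 * (m + 1)"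
    by (intro add_mono mult_le_mono order_refl q3 sq1)
  also have "\<dots> = (b * b ^ s + b * (s + 1) * (b ^ s * b ^ s) + b ^ s * (m + 1)) * q ^ 3"
    by (simp add: power3_eq_cube algebra_simps)
  also have "\<dots> \<le> c * q ^ 3"
    unfolding c_def by (intro mult_le_mono1) simp
  finally show "sampled_pw_poly b s q q a \<in> approx_set b m \<phi> (compl_C b m) (c * q ^ 3)"
    unfolding approx_set_def using v by blast
qed

lemma best_error_rate:
  fixes C :: real and c k :: nat
  assumes "1 \<le> c" "1 \<le> k" "1 \<le> n" "C > 0"
    and bound: "\<And>x. x \<in> {0..<1} \<Longrightarrow> \<bar>f x\<bar> \<le> C"
    and meas: "f \<in> borel_measurable (lebesgue_on {0..<1})"
      "\<And>q. g q \<in> borel_measurable (lebesgue_on {0..<1})"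
    and err: "\<And>q x. x \<in> {0..<1} \<Longrightarrow> \<bar>f x - g q x\<bar> \<le> C / 2 ^ q"
    and mem: "\<And>q. 1 \<le> q \<Longrightarrow> g q \<in> approx_set b m \<phi> cmp (c * q ^ k)"
  shows "best_error (approx_set b m \<phi> cmp n) f
     \<le> ennreal (2 * C * (2 powr (1 / real c)) powr (- (real n powr (1 / real k))))"
proof -
  obtain q where q: "c * q ^ k \<le> n"
    and rate: "1 / 2 ^ q \<le> 2 * (2 powr (1 / real c)) powr (- (real n powr (1 / real k)))"
    using budget_to_order[of c n k] assms by blast
  \<comment> \<open>For budgets too small for a network of order one, \<open>q = 0\<close> and the zero function is used.\<close>
  define g' where "g' = (if q = 0 then \<lambda>_. 0 else g q)"
  have "best_error (approx_set b m \<phi> cmp n) f \<le> ennreal (C / 2 ^ q)"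
  proof (rule best_error_le)
    show "g' \<in> approx_set b m \<phi> cmp n"
    proof (cases "q = 0")
      case False
      then have "g q \<in> approx_set b m \<phi> cmp (c * q ^ k)" by (intro mem) simp
      then show ?thesis
        using q False unfolding g'_def approx_set_def by fastforce
    qed (simp add: g'_def approx_set_def)
    show "(\<lambda>x. f x - g' x) \<in> borel_measurable (lebesgue_on {0..<1})"
      using meas by (simp add: g'_def)
    show "\<bar>f x - g' x\<bar> \<le> C / 2 ^ q" if "x \<in> {0..<1}" for x
      using bound[OF that] err[OF that, of q] by (simp add: g'_def)
  qed
  also have "C / 2 ^ q \<le> 2 * C * (2 powr (1 / real c)) powr (- (real n powr (1 / real k)))"
    using mult_left_mono[OF rate, of C] \<open>C > 0\<close> by (simp add: mult_ac)
  finally show ?thesis by (simp add: ennreal_leI)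
qed

theorem mainTheorem4:
  fixes b m :: nat
    and \<phi> :: "nat \<Rightarrow> real poly"
    and f :: "real \<Rightarrow> real"
    and F :: "complex \<Rightarrow> complex"
    and D :: "complex set"
  assumes "2 \<le> b"
    and "is_poly_basis m \<phi>"
    and "open D" and "connected D" and "complex_of_real ` {0..1} \<subseteq> D"
    and "F analytic_on D"
    and "\<And>x. x \<in> {0..<1} \<Longrightarrow> F (complex_of_real x) = complex_of_real (f x)"
  shows "\<exists>C \<rho> :: real. C > 1 \<and> \<rho> > 1 \<and>
    (\<forall>n::nat. n \<ge> 1 \<longrightarrow>
       E_N b m \<phi> n f \<le> ennreal (C * \<rho> powr (- (real n powr (1/2)))) \<and>
       E_S b m \<phi> n f \<le> E_C b m \<phi> n f \<and>
       E_C b m \<phi> n f \<le> ennreal (C * \<rho> powr (- (real n powr (1/3)))))"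
proof -
  obtain s a C where C: "C > 0" and bound: "\<And>x. x \<in> {0..<1} \<Longrightarrow> \<bar>f x\<bar> \<le> C"
    and err: "\<And>q x. x \<in> {0..<1} \<Longrightarrow> \<bar>f x - sampled_pw_poly b s q q a x\<bar> \<le> C / 2 ^ q"
    by (rule sampled_taylor_error[OF assms(1,3,5,6), of f]) (rule assms(7), assumption, rule that)
  define c where "c = (s + 1) * b ^ s + b * b ^ s + b * (s + 1) * (b ^ s * b ^ s) + b ^ s * (m + 1)"
  have "1 \<le> b ^ s" using assms(1) by simp
  then have c: "1 \<le> c" by (simp add: c_def)
  have "continuous_on D F"
    using assms(6) by (intro holomorphic_on_imp_continuous_on analytic_imp_holomorphic)
  moreover have "complex_of_real ` {0..<1} \<subseteq> D"
    using assms(5) by (auto simp: image_subset_iff)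
  ultimately have "continuous_on {0..<1} (\<lambda>x. F (complex_of_real x))"
    by (rule continuous_on_compose2[OF _ continuous_on_of_real_id])
  then have "continuous_on {0..<1} (\<lambda>x. Re (F (complex_of_real x)))"
    by (rule continuous_on_Re)
  then have "continuous_on {0..<1} f"
    by (rule continuous_on_eq) (simp add: assms(7))
  then have meas: "f \<in> borel_measurable (lebesgue_on {0..<1})"
    by (rule continuous_imp_measurable_on_sets_lebesgue) simp
  define \<rho> where "\<rho> = (2::real) powr (1 / real c)"
  have rate: "best_error (approx_set b m \<phi> cmp n) f
      \<le> ennreal ((2 * C + 1) * \<rho> powr (- (real n powr (1 / real k))))"
    if "1 \<le> n" "1 \<le> k"
      and "\<And>q. 1 \<le> q \<Longrightarrow> sampled_pw_poly b s q q a \<in> approx_set b m \<phi> cmp (c * q ^ k)" for n k cmp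
  proof -
    have "best_error (approx_set b m \<phi> cmp n) f
        \<le> ennreal (2 * C * \<rho> powr (- (real n powr (1 / real k))))"
      unfolding \<rho>_def
      using best_error_rate[OF c that(2,1) C bound meas sampled_pw_poly_measurable err that(3)] .
    also have "\<dots> \<le> ennreal ((2 * C + 1) * \<rho> powr (- (real n powr (1 / real k))))"
      by (intro ennreal_leI mult_right_mono) auto
    finally show ?thesis .
  qed
  have "\<rho> > 1" using c by (simp add: \<rho>_def)
  moreover have "2 * C + 1 > 1" using C by simp
  moreover have "E_N b m \<phi> n f \<le> ennreal ((2 * C + 1) * \<rho> powr (- (real n powr (1/2))))" if "n \<ge> 1" for n
    unfolding E_N_def
    using rate[OF that, of 2 compl_N] sampled_pw_poly_in_approx_sets(1)[OF assms(1,2)]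
    by (simp add: c_def)
  moreover have "E_C b m \<phi> n f \<le> ennreal ((2 * C + 1) * \<rho> powr (- (real n powr (1/3))))" if "n \<ge> 1" for n
    unfolding E_C_def
    using rate[OF that, of 3 "compl_C b m"] sampled_pw_poly_in_approx_sets(2)[OF assms(1,2)]
    by (simp add: c_def)
  ultimately show ?thesis
    using E_S_le_E_C by blast
qed

end
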